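(* Let $\kappa,\theta,\lambda$ be cardinals with $\aleph_0\le\theta\le\kappa$ and $\theta\le\lambda$. Let $Y\subseteq(2^\lambda)_\theta$ be a dense subset, with the subspace topology. Then $\mathrm{Nt}(Y)\le\kappa$ if and only if there is a $(\kappa,\theta)$-sparse cofinal family in $([\lambda]^{<\theta},\subseteq)$.
   Context: For a cardinal $\kappa$, a family $\mathcal B$ of sets is called $\kappa^{\mathrm{op}}$-like if for every $U\in\mathcal B$ the set $\{V\in\mathcal B: U\subseteq V\}$ has cardinality $<\kappa$. The Noetherian type $\mathrm{Nt}(X)$ of a topological space $X$ is the least infinite cardinal $\kappa$ such that $X$ has a base which is $\kappa^{\mathrm{op}}$-like. For a space $X$ and infinite cardinal $\theta$, $X_\theta$ is the space obtained from $X$ by declaring all intersections of fewer than $\theta$ open sets to be open. Here $2^\lambda$ denotes the Cantor cube $\{0,1\}^\lambda$ with the product topology. $[\lambda]^{<\theta}$ is the set of subsets of $\lambda$ of cardinality $<\theta$. A family of sets $\mathcal F$ is $(\kappa,\theta)$-sparse if for every $\mathcal G\subseteq\mathcal F$ with $|\mathcal G|\ge\kappa$ we have $|\bigcup\mathcal G|\ge\theta$. *)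

theory Defs
  imports "HOL-Analysis.Analysis"
begin

text \<open>
  Cardinals are rendered by the cardinal orders of \<open>HOL.BNF_Cardinal_Order_Relation\<close>,
  compared across types by \<open>\<le>o\<close> and \<open><o\<close>; \<open>natLeq\<close> is aleph-null.
\<close>

unbundle cardinal_syntax

definition op_like :: "'k rel \<Rightarrow> 'a set set \<Rightarrow> bool"
  where "op_like \<kappa> \<B> \<longleftrightarrow> (\<forall>U\<in>\<B>. |{V \<in> \<B>. U \<subseteq> V}| <o \<kappa>)"

definition base_of :: "'a topology \<Rightarrow> 'a set set \<Rightarrow> bool"
  where "base_of X \<B> \<longleftrightarrow> openin X = arbitrary union_of (\<lambda>B. B \<in> \<B>)"

definition has_op_like_base :: "'a topology \<Rightarrow> 'k rel \<Rightarrow> bool"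
  where "has_op_like_base X \<kappa> \<longleftrightarrow> (\<exists>\<B>. base_of X \<B> \<and> op_like \<kappa> \<B>)"

text \<open>
  The type \<open>('a set + nat) set\<close> is large enough to carry the least cardinal in question (it
  carries the successor of an infinite cardinal bounding the number of open sets).  The lemmas
  below show that the choice is well-defined and that its value is least among the infinite
  cardinals on all types, not only on this one.
\<close>

definition Nt :: "'a topology \<Rightarrow> ('a set + nat) set rel"
  where "Nt X =
    (SOME \<kappa>. Card_order \<kappa> \<and> natLeq \<le>o \<kappa> \<and> has_op_like_base X \<kappa> \<and>
       (\<forall>\<kappa>' :: ('a set + nat) set rel.
          Card_order \<kappa>' \<and> natLeq \<le>o \<kappa>' \<and> has_op_like_base X \<kappa>' \<longrightarrow> \<kappa> \<le>o \<kappa>'))"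

lemma has_op_like_base_mono:
  assumes "has_op_like_base X \<kappa>" and le: "\<kappa> \<le>o \<kappa>'"
  shows "has_op_like_base X \<kappa>'"
proof -
  obtain \<B> where "base_of X \<B>" "op_like \<kappa> \<B>"
    using assms(1) unfolding has_op_like_base_def by auto
  moreover have "op_like \<kappa>' \<B>"
    unfolding op_like_def
  proof
    fix U assume "U \<in> \<B>"
    then have "|{V \<in> \<B>. U \<subseteq> V}| <o \<kappa>" using \<open>op_like \<kappa> \<B>\<close> unfolding op_like_def by (rule bspec [rotated])
    then show "|{V \<in> \<B>. U \<subseteq> V}| <o \<kappa>'" using le by (rule ordLess_ordLeq_trans)
  qed
  ultimately show ?thesis unfolding has_op_like_base_def by auto
qed

lemma ex_has_op_like_base:
  fixes X :: "'a topology"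
  shows "\<exists>\<kappa> :: ('a set + nat) set rel. Card_order \<kappa> \<and> natLeq \<le>o \<kappa> \<and> has_op_like_base X \<kappa>"
proof (intro exI conjI)
  let ?U = "UNIV :: ('a set + nat) set"
  let ?k = "cardSuc |?U|"
  have lt: "|?U| <o ?k" by (rule cardSuc_greater [OF card_of_Card_order])
  show "Card_order ?k" by (rule cardSuc_Card_order [OF card_of_Card_order])
  have "infinite ?U" by simp
  then have "natLeq \<le>o |?U|" using infinite_iff_natLeq_ordLeq [of ?U] by simp
  then show "natLeq \<le>o ?k"
    by (rule ordLeq_transitive [OF _ ordLess_imp_ordLeq [OF lt]])
  have small: "|\<C>| <o ?k" for \<C> :: "'a set set"
  proof -
    have "|\<C>| \<le>o |?U|"
      by (rule card_of_ordLeqI [of Inl]) (auto simp: inj_on_def)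
    then show ?thesis using lt by (rule ordLeq_ordLess_trans)
  qed
  have "base_of X {U. openin X U}"
    unfolding base_of_def openin_topology_base_unique by auto
  moreover have "op_like ?k {U. openin X U}"
    unfolding op_like_def using small by simp
  ultimately show "has_op_like_base X ?k"
    unfolding has_op_like_base_def by auto
qed

lemma
  fixes X :: "'a topology"
  shows Card_order_Nt: "Card_order (Nt X)"
    and natLeq_ordLeq_Nt: "natLeq \<le>o Nt X"
    and has_op_like_base_Nt: "has_op_like_base X (Nt X)"
    and Nt_least: "\<lbrakk>Card_order \<kappa>; natLeq \<le>o \<kappa>; has_op_like_base X \<kappa>\<rbrakk> \<Longrightarrow> Nt X \<le>o \<kappa>"
proof -
  define P where "P \<kappa> \<longleftrightarrow> Card_order \<kappa> \<and> natLeq \<le>o \<kappa> \<and> has_op_like_base X \<kappa>"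
    for \<kappa> :: "('a set + nat) set rel"
  obtain \<kappa>0 where "P \<kappa>0" using ex_has_op_like_base [of X] unfolding P_def by (rule exE)
  then have "Collect P \<noteq> {}" by auto
  moreover have "\<forall>r\<in>Collect P. Card_order r" unfolding P_def by simp
  ultimately have "\<exists>\<kappa>\<in>Collect P. \<forall>\<kappa>'\<in>Collect P. \<kappa> \<le>o \<kappa>'"
    by (rule exists_minim_Card_order)
  then have ex: "\<exists>\<kappa>. P \<kappa> \<and> (\<forall>\<kappa>'. P \<kappa>' \<longrightarrow> \<kappa> \<le>o \<kappa>')" by simp
  have "Nt X = (SOME \<kappa>. P \<kappa> \<and> (\<forall>\<kappa>'. P \<kappa>' \<longrightarrow> \<kappa> \<le>o \<kappa>'))"
    unfolding Nt_def P_def conj_assoc ..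
  then have "P (Nt X) \<and> (\<forall>\<kappa>'. P \<kappa>' \<longrightarrow> Nt X \<le>o \<kappa>')"
    using someI_ex [OF ex] by simp
  then have N: "P (Nt X)" and least: "\<And>\<kappa>'. P \<kappa>' \<Longrightarrow> Nt X \<le>o \<kappa>'" by simp_all
  show Nt: "Card_order (Nt X)" "natLeq \<le>o Nt X" "has_op_like_base X (Nt X)"
    using N unfolding P_def by simp_all
  show "Nt X \<le>o \<kappa>" if k: "Card_order \<kappa>" "natLeq \<le>o \<kappa>" "has_op_like_base X \<kappa>"
  proof (rule ccontr)
    assume no: "\<not> Nt X \<le>o \<kappa>"
    have "Well_order \<kappa>" "Well_order (Nt X)"
      using k(1) Nt(1) unfolding card_order_on_def by simp_all
    then have "\<kappa> \<le>o Nt X" using ordLeq_total no by auto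
    then obtain p :: "('a set + nat) set rel" where p: "\<kappa> =o p"
      unfolding internalize_ordLeq [of \<kappa>] by auto
    have "P p"
      unfolding P_def
      using Card_order_ordIso [OF k(1) ordIso_symmetric [OF p]]
        ordLeq_ordIso_trans [OF k(2) p]
        has_op_like_base_mono [OF k(3) ordIso_imp_ordLeq [OF p]] by simp
    then show False
      using ordLeq_ordIso_trans [OF least ordIso_symmetric [OF p]] no by simp
  qed
qed

text \<open>
  Intersecting with the underlying space only affects the empty intersection, which is
  \<open>UNIV\<close> in HOL.
\<close>

definition lt_open_topology :: "'a topology \<Rightarrow> 't rel \<Rightarrow> 'a topology"
  where "lt_open_topology X \<theta> =
    topology_generated_by
      {topspace X \<inter> \<Inter>\<U> |\<U>. (\<forall>U\<in>\<U>. openin X U) \<and> |\<U>| <o \<theta>}"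

definition cantor_cube :: "'l rel \<Rightarrow> ('l \<Rightarrow> bool) topology"
  where "cantor_cube \<nu> = product_topology (\<lambda>_. discrete_topology UNIV) (Field \<nu>)"

definition subsets_lt :: "'l rel \<Rightarrow> 't rel \<Rightarrow> 'l set set"
  where "subsets_lt \<nu> \<theta> = {A. A \<subseteq> Field \<nu> \<and> |A| <o \<theta>}"

definition sparse_family :: "'k rel \<Rightarrow> 't rel \<Rightarrow> 'l set set \<Rightarrow> bool"
  where "sparse_family \<kappa> \<theta> \<F> \<longleftrightarrow> (\<forall>\<G>\<subseteq>\<F>. \<kappa> \<le>o |\<G>| \<longrightarrow> \<theta> \<le>o |\<Union>\<G>| )"

text \<open>Not the library's \<open>cofinal\<close>, which demands strictly larger elements.\<close>

definition cofinal_family :: "'l set set \<Rightarrow> 'l set set \<Rightarrow> bool"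
  where "cofinal_family \<P> \<F> \<longleftrightarrow> \<F> \<subseteq> \<P> \<and> (\<forall>A\<in>\<P>. \<exists>B\<in>\<F>. A \<subseteq> B)"

end

theory Submission
  imports Defs
begin

text \<open>
  A basic open set of the \<open>\<theta>\<close>-modified Cantor cube is a cylinder: it fixes the values on
  fewer than \<open>\<theta>\<close> coordinates (\<open>openin_lt_open_cantor_cube_iff\<close>).  Sparseness of a family \<open>\<F>\<close>
  says that every set of fewer than \<open>\<theta>\<close> coordinates contains fewer than \<open>\<kappa>\<close> members of \<open>\<F>\<close>
  (\<open>sparse_family_iff\<close>).  Thus larger coordinate sets correspond to smaller cylinders, and
  having few members below a given set corresponds to having few basic open sets above a given
  one.

  From a sparse cofinal \<open>\<F>\<close>, the traces on \<open>Y\<close> of the cylinders supported on members of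
  \<open>\<F>\<close> form a base.  Because \<open>Y\<close> is dense, an inclusion between two such traces forces an
  inclusion of the supports (\<open>cylinder_trace_subset_imp\<close>), and a larger cylinder is determined
  by its support once a smaller one is given.  So a trace has no more supersets in the base than
  its support has subsets in \<open>\<F>\<close>.

  From a \<open>\<kappa>\<close>-op-like base, fix a single point \<open>y\<close> of \<open>Y\<close> and shrink each basic neighbourhood
  \<open>U\<close> of \<open>y\<close> to a cylinder around \<open>y\<close>, with support \<open>D U\<close>.  Working at one point is what
  makes the argument go through: all these cylinders agree with \<open>y\<close>, so those with support inside
  a fixed small \<open>C\<close> contain the cylinder around \<open>y\<close> with support \<open>C\<close>, and hence some one basic
  set \<open>V\<close>.  There are fewer than \<open>\<kappa>\<close> basic sets above \<open>V\<close>, so the supports \<open>D U\<close> form a sparse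
  family.
\<close>

section \<open>Cardinalities below an infinite cardinal\<close>

lemma finite_ordLess_infinite_cardinal:
  assumes "natLeq \<le>o \<theta>" and "finite A"
  shows "|A| <o \<theta>"
  using assms finite_iff_ordLess_natLeq ordLess_ordLeq_trans by blast

text \<open>
  A union of fewer than \<open>\<theta>\<close> finite sets stays small even for singular \<open>\<theta>\<close>: for an infinite
  index set the union has at most as many elements as the index set.
\<close>

lemma card_UNION_finite_ordLess:
  assumes "natLeq \<le>o \<theta>" and "|I| <o \<theta>" and "\<And>i. i \<in> I \<Longrightarrow> finite (A i)"
  shows "|\<Union>i\<in>I. A i| <o \<theta>"
proof (cases "finite I")
  case True
  then show ?thesis
    using assms by (intro finite_ordLess_infinite_cardinal) auto
next
  case False
  have "|A i| \<le>o |I|" if "i \<in> I" for i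
    using assms(3)[OF that] False
    by (intro ordLess_imp_ordLeq finite_ordLess_infinite[OF card_of_Well_order card_of_Well_order])
      (auto simp: Field_card_of)
  then have "|\<Union>i\<in>I. A i| \<le>o |I|"
    using False by (intro card_of_UNION_ordLeq_infinite ballI card_of_mono1 order_refl)
  then show ?thesis
    using assms(2) ordLeq_ordLess_trans by blast
qed

lemma card_Un_ordLess:
  assumes "Card_order \<theta>" and "natLeq \<le>o \<theta>" and "|A| <o \<theta>" and "|B| <o \<theta>"
  shows "|A \<union> B| <o \<theta>"
  using assms natLeq_ordLeq_cinfinite card_of_Un_ordLess_infinite_Field cinfinite_def
  by (metis Field_natLeq card_of_ordLeq_infinite card_of_Field_ordIso card_of_mono2
      infinite_UNIV_nat)

text \<open>The form of sparseness in which both directions use it: count the members below a small set.\<close>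

lemma sparse_family_iff:
  assumes "Card_order \<kappa>" and "Card_order \<theta>"
  shows "sparse_family \<kappa> \<theta> \<F> \<longleftrightarrow> (\<forall>C. |C| <o \<theta> \<longrightarrow> |{A \<in> \<F>. A \<subseteq> C}| <o \<kappa>)"
proof -
  have k: "\<kappa> \<le>o |X| \<longleftrightarrow> \<not> |X| <o \<kappa>" for X :: "'d set"
    using assms(1) card_of_Well_order card_order_on_def not_ordLess_iff_ordLeq by blast
  have t: "\<theta> \<le>o |X| \<longleftrightarrow> \<not> |X| <o \<theta>" for X :: "'d set"
    using assms(2) card_of_Well_order card_order_on_def not_ordLess_iff_ordLeq by blast
  show ?thesis
  proof (intro iffI allI impI)
    fix C :: "'c set"
    assume sp: "sparse_family \<kappa> \<theta> \<F>" and C: "|C| <o \<theta>"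
    have "|\<Union>{A \<in> \<F>. A \<subseteq> C}| \<le>o |C|"
      by (intro card_of_mono1) auto
    then have "|\<Union>{A \<in> \<F>. A \<subseteq> C}| <o \<theta>"
      using C ordLeq_ordLess_trans by blast
    then show "|{A \<in> \<F>. A \<subseteq> C}| <o \<kappa>"
      using sp unfolding sparse_family_def
      by (metis (no_types, lifting) k t mem_Collect_eq subsetI)
  next
    assume few: "\<forall>C. |C| <o \<theta> \<longrightarrow> |{A \<in> \<F>. A \<subseteq> C}| <o \<kappa>"
    show "sparse_family \<kappa> \<theta> \<F>"
      unfolding sparse_family_def
    proof (intro allI impI, rule ccontr)
      fix \<G> assume G: "\<G> \<subseteq> \<F>" "\<kappa> \<le>o |\<G>|" "\<not> \<theta> \<le>o |\<Union>\<G>|"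
      have "|\<G>| \<le>o |{A \<in> \<F>. A \<subseteq> \<Union>\<G>}|"
        using G(1) by (intro card_of_mono1) auto
      moreover have "|{A \<in> \<F>. A \<subseteq> \<Union>\<G>}| <o \<kappa>"
        using few G(3) t by blast
      ultimately show False
        using G(2) k ordLeq_ordLess_trans by blast
    qed
  qed
qed

section \<open>Cylinders in the Cantor cube\<close>

definition cylinder :: "'l rel \<Rightarrow> 'l set \<Rightarrow> ('l \<Rightarrow> bool) \<Rightarrow> ('l \<Rightarrow> bool) set"
  where "cylinder \<nu> A x = {z \<in> topspace (cantor_cube \<nu>). \<forall>i\<in>A. z i = x i}"

lemma topspace_cantor_cube: "topspace (cantor_cube \<nu>) = (\<Pi>\<^sub>E i\<in>Field \<nu>. UNIV)"
  by (simp add: cantor_cube_def)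

lemma mem_cylinder_self: "x \<in> topspace (cantor_cube \<nu>) \<Longrightarrow> x \<in> cylinder \<nu> A x"
  by (simp add: cylinder_def)

lemma cylinder_anti_mono: "A \<subseteq> B \<Longrightarrow> cylinder \<nu> B x \<subseteq> cylinder \<nu> A x"
  by (auto simp: cylinder_def)

lemma cylinder_eq_if_mem: "z \<in> cylinder \<nu> A x \<Longrightarrow> cylinder \<nu> A z = cylinder \<nu> A x"
  by (auto simp: cylinder_def)

lemma topspace_lt_open_topology:
  fixes X :: "'a topology"
  assumes "natLeq \<le>o \<theta>"
  shows "topspace (lt_open_topology X \<theta>) = topspace X"
proof -
  have "|{}::'a set set| <o \<theta>"
    using assms by (intro finite_ordLess_infinite_cardinal) auto
  \<comment> \<open>The empty intersection contributes the whole space.\<close>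
  then have "topspace X \<in>
      {topspace X \<inter> \<Inter>\<U> |\<U>. (\<forall>U\<in>\<U>. openin X U) \<and> |\<U>| <o \<theta>}"
    by (intro CollectI exI[of _ "{}"]) auto
  then show ?thesis
    unfolding lt_open_topology_def topology_generated_by_topspace by auto
qed

lemma openin_cantor_cube_imp_cylinder:
  assumes "openin (cantor_cube \<nu>) U" and "x \<in> U"
  shows "\<exists>A. finite A \<and> A \<subseteq> Field \<nu> \<and> cylinder \<nu> A x \<subseteq> U"
proof -
  obtain W where W: "finite {i \<in> Field \<nu>. W i \<noteq> (UNIV::bool set)}"
      "x \<in> Pi\<^sub>E (Field \<nu>) W" "Pi\<^sub>E (Field \<nu>) W \<subseteq> U"
    using assms unfolding cantor_cube_def openin_product_topology_alt by fastforce
  have "cylinder \<nu> {i \<in> Field \<nu>. W i \<noteq> UNIV} x \<subseteq> Pi\<^sub>E (Field \<nu>) W"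
  proof
    fix z assume z: "z \<in> cylinder \<nu> {i \<in> Field \<nu>. W i \<noteq> UNIV} x"
    have "z i \<in> W i" if "i \<in> Field \<nu>" for i
      using z W(2) that by (cases "W i = UNIV") (auto simp: cylinder_def)
    then show "z \<in> Pi\<^sub>E (Field \<nu>) W"
      using z by (auto simp: cylinder_def topspace_cantor_cube PiE_iff)
  qed
  then show ?thesis
    using W by (intro exI[of _ "{i \<in> Field \<nu>. W i \<noteq> UNIV}"]) auto
qed

lemma openin_coordinate_eq:
  assumes "i \<in> Field \<nu>"
  shows "openin (cantor_cube \<nu>) {z \<in> topspace (cantor_cube \<nu>). z i = b}"
proof -
  have "continuous_map (cantor_cube \<nu>) (discrete_topology UNIV) (\<lambda>z. z i)"
    using assms unfolding cantor_cube_def by (rule continuous_map_product_projection)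
  then show ?thesis
    using openin_continuous_map_preimage[of _ _ _ "{b}"] by fastforce
qed

lemma openin_cylinder:
  assumes "natLeq \<le>o \<theta>" and "A \<in> subsets_lt \<nu> \<theta>"
  shows "openin (lt_open_topology (cantor_cube \<nu>) \<theta>) (cylinder \<nu> A x)"
proof -
  let ?S = "\<lambda>i. {z \<in> topspace (cantor_cube \<nu>). z i = x i}"
  have "cylinder \<nu> A x = topspace (cantor_cube \<nu>) \<inter> \<Inter>(?S ` A)"
    by (auto simp: cylinder_def)
  moreover have "\<forall>U\<in>?S ` A. openin (cantor_cube \<nu>) U"
    using assms(2) by (auto simp: subsets_lt_def intro: openin_coordinate_eq)
  moreover have "|?S ` A| <o \<theta>"
    using assms(2) card_of_image ordLeq_ordLess_trans unfolding subsets_lt_def by blast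
  ultimately show ?thesis
    unfolding lt_open_topology_def by (intro topology_generated_by_Basis) blast
qed

text \<open>
  An intersection of fewer than \<open>\<theta>\<close> open sets of the cube contains, around each of its points,
  an intersection of fewer than \<open>\<theta>\<close> cylinders with \<^emph>\<open>finite\<close> supports.  This is a cylinder
  supported on the union of these supports, which has fewer than \<open>\<theta>\<close> elements.
\<close>

lemma openin_lt_open_cantor_cube_iff:
  assumes "Card_order \<theta>" and "natLeq \<le>o \<theta>"
  shows "openin (lt_open_topology (cantor_cube \<nu>) \<theta>) S \<longleftrightarrow>
    S \<subseteq> topspace (cantor_cube \<nu>) \<and> (\<forall>x\<in>S. \<exists>A\<in>subsets_lt \<nu> \<theta>. cylinder \<nu> A x \<subseteq> S)"
    (is "?open S \<longleftrightarrow> ?P S")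
proof
  assume "?open S"
  then have "generate_topology_on
      {topspace (cantor_cube \<nu>) \<inter> \<Inter>\<U> |\<U>. (\<forall>U\<in>\<U>. openin (cantor_cube \<nu>) U) \<and> |\<U>| <o \<theta>} S"
    unfolding lt_open_topology_def by (rule openin_topology_generated_by)
  then show "?P S"
  proof induction
    case Empty
    then show ?case by simp
  next
    case (Int S T)
    have "\<exists>A\<in>subsets_lt \<nu> \<theta>. cylinder \<nu> A x \<subseteq> S \<inter> T" if x: "x \<in> S \<inter> T" for x
    proof -
      obtain A B where "A \<in> subsets_lt \<nu> \<theta>" "B \<in> subsets_lt \<nu> \<theta>"
          "cylinder \<nu> A x \<subseteq> S" "cylinder \<nu> B x \<subseteq> T"
        using x Int.IH by blast
      then show ?thesis
        using card_Un_ordLess[OF assms]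
        by (intro bexI[of _ "A \<union> B"]) (auto simp: subsets_lt_def cylinder_def subset_iff)
    qed
    then show ?case
      using Int.IH by blast
  next
    case (UN K)
    then show ?case
      by (meson Sup_least Union_iff Union_upper subset_trans)
  next
    case (Basis S)
    then obtain \<U> where S: "S = topspace (cantor_cube \<nu>) \<inter> \<Inter>\<U>"
      and op: "\<forall>U\<in>\<U>. openin (cantor_cube \<nu>) U" and lt: "|\<U>| <o \<theta>"
      by blast
    have "\<exists>A\<in>subsets_lt \<nu> \<theta>. cylinder \<nu> A x \<subseteq> S" if x: "x \<in> S" for x
    proof -
      have "\<forall>U\<in>\<U>. \<exists>A. finite A \<and> A \<subseteq> Field \<nu> \<and> cylinder \<nu> A x \<subseteq> U"
        using x S op openin_cantor_cube_imp_cylinder by blast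
      then obtain A where A: "\<And>U. U \<in> \<U> \<Longrightarrow> finite (A U)"
          "\<And>U. U \<in> \<U> \<Longrightarrow> A U \<subseteq> Field \<nu>" "\<And>U. U \<in> \<U> \<Longrightarrow> cylinder \<nu> (A U) x \<subseteq> U"
        by metis
      have "(\<Union>U\<in>\<U>. A U) \<in> subsets_lt \<nu> \<theta>"
        using A card_UNION_finite_ordLess[OF assms(2) lt] unfolding subsets_lt_def by blast
      moreover have "cylinder \<nu> (\<Union>U\<in>\<U>. A U) x \<subseteq> U" if "U \<in> \<U>" for U
        using cylinder_anti_mono[of "A U" "\<Union>U\<in>\<U>. A U" \<nu> x] A(3)[OF that] UN_upper[OF that]
        by (meson order_trans)
      then have "cylinder \<nu> (\<Union>U\<in>\<U>. A U) x \<subseteq> S"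
        unfolding S by (auto simp: cylinder_def)
      ultimately show ?thesis by blast
    qed
    then show ?case
      using S by blast
  qed
next
  assume P: "?P S"
  have "\<exists>T. ?open T \<and> x \<in> T \<and> T \<subseteq> S" if x: "x \<in> S" for x
  proof -
    obtain A where "A \<in> subsets_lt \<nu> \<theta>" "cylinder \<nu> A x \<subseteq> S"
      using P x by blast
    moreover have "x \<in> cylinder \<nu> A x"
      using P x by (blast intro: mem_cylinder_self)
    ultimately show ?thesis
      using openin_cylinder[OF assms(2)] by blast
  qed
  then show "?open S"
    by (intro iffD2[OF openin_subopen] ballI)
qed

section \<open>Traces of cylinders on a dense set\<close>

text \<open>
  If some coordinate \<open>i\<close> of \<open>B\<close> were missing from \<open>A\<close>, then \<open>x\<close> could be altered at \<open>i\<close> so as to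
  disagree there with \<open>z\<close>; density yields a point of \<open>Y\<close> in the cylinder of the altered point
  with support \<open>insert i A\<close>, which lies in the first trace but not in the second.
\<close>

lemma cylinder_trace_subset_imp:
  assumes "Card_order \<theta>" and "natLeq \<le>o \<theta>"
    and dense: "lt_open_topology (cantor_cube \<nu>) \<theta> closure_of Y = topspace (cantor_cube \<nu>)"
    and A: "A \<in> subsets_lt \<nu> \<theta>" and B: "B \<in> subsets_lt \<nu> \<theta>"
    and x: "x \<in> topspace (cantor_cube \<nu>)"
    and sub: "cylinder \<nu> A x \<inter> Y \<subseteq> cylinder \<nu> B z"
  shows "B \<subseteq> A"
proof
  fix i assume i: "i \<in> B"
  show "i \<in> A"
  proof (rule ccontr)
    assume "i \<notin> A"
    let ?x = "x(i := \<not> z i)"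
    have i': "i \<in> Field \<nu>"
      using i B by (auto simp: subsets_lt_def)
    then have x': "?x \<in> topspace (cantor_cube \<nu>)"
      using x by (auto simp: topspace_cantor_cube PiE_iff extensional_def)
    have "|insert i A| <o \<theta>"
      using card_Un_ordLess[OF assms(1,2), of "{i}" A] A
        finite_ordLess_infinite_cardinal[OF assms(2), of "{i}"]
      by (simp add: subsets_lt_def)
    then have "insert i A \<in> subsets_lt \<nu> \<theta>"
      using A i' by (simp add: subsets_lt_def)
    then have "openin (lt_open_topology (cantor_cube \<nu>) \<theta>) (cylinder \<nu> (insert i A) ?x)"
      by (rule openin_cylinder[OF assms(2)])
    then obtain y where "y \<in> Y" "y \<in> cylinder \<nu> (insert i A) ?x"
      using dense x' mem_cylinder_self[OF x'] unfolding closure_of_def by blast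
    moreover from this have "y \<in> cylinder \<nu> A x"
      using \<open>i \<notin> A\<close> by (auto simp: cylinder_def)
    ultimately have "y i = z i" "y i = (\<not> z i)"
      using sub i by (auto simp: cylinder_def)
    then show False by simp
  qed
qed

text \<open>
  The base consists of the traces centred at points of \<open>Y\<close>, so none of them is empty: an
  empty member would lie below the whole base.
\<close>

lemma has_op_like_base_if_sparse_cofinal:
  assumes \<kappa>: "Card_order \<kappa>" and \<theta>: "Card_order \<theta>" and inf: "natLeq \<le>o \<theta>"
    and Y: "Y \<subseteq> topspace (cantor_cube \<nu>)"
    and dense: "lt_open_topology (cantor_cube \<nu>) \<theta> closure_of Y = topspace (cantor_cube \<nu>)"
    and sparse: "sparse_family \<kappa> \<theta> \<F>"
    and cofinal: "cofinal_family (subsets_lt \<nu> \<theta>) \<F>"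
  shows "has_op_like_base (subtopology (lt_open_topology (cantor_cube \<nu>) \<theta>) Y) \<kappa>"
proof -
  let ?X = "lt_open_topology (cantor_cube \<nu>) \<theta>"
  define \<B> where "\<B> = {cylinder \<nu> A x \<inter> Y |A x. A \<in> \<F> \<and> x \<in> Y}"
  have F: "A \<in> subsets_lt \<nu> \<theta>" if "A \<in> \<F>" for A
    using that cofinal by (auto simp: cofinal_family_def)
  have "base_of (subtopology ?X Y) \<B>"
    unfolding base_of_def openin_topology_base_unique
  proof (intro conjI allI impI)
    fix V assume "V \<in> \<B>"
    then show "openin (subtopology ?X Y) V"
      using F openin_cylinder[OF inf] unfolding \<B>_def openin_subtopology by blast
  next
    fix U x assume "openin (subtopology ?X Y) U \<and> x \<in> U"
    then obtain S where S: "openin ?X S" "U = S \<inter> Y" "x \<in> S" "x \<in> Y"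
      by (auto simp: openin_subtopology)
    then obtain A where A: "A \<in> subsets_lt \<nu> \<theta>" "cylinder \<nu> A x \<subseteq> S"
      using openin_lt_open_cantor_cube_iff[OF \<theta> inf] by blast
    then obtain B where B: "B \<in> \<F>" "A \<subseteq> B"
      using cofinal by (auto simp: cofinal_family_def)
    have "x \<in> cylinder \<nu> B x \<inter> Y"
      using S(4) Y mem_cylinder_self by blast
    moreover have "cylinder \<nu> B x \<inter> Y \<subseteq> U"
      using cylinder_anti_mono[OF B(2)] A(2) S(2) by blast
    moreover have "cylinder \<nu> B x \<inter> Y \<in> \<B>"
      using B(1) S(4) by (auto simp: \<B>_def)
    ultimately show "\<exists>V. V \<in> \<B> \<and> x \<in> V \<and> V \<subseteq> U"
      by blast
  qed
  moreover have "op_like \<kappa> \<B>"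
    unfolding op_like_def
  proof
    fix U assume "U \<in> \<B>"
    then obtain A x where A: "A \<in> \<F>" and x: "x \<in> Y" and U: "U = cylinder \<nu> A x \<inter> Y"
      by (auto simp: \<B>_def)
    have xX: "x \<in> topspace (cantor_cube \<nu>)"
      using x Y by blast
    have "{V \<in> \<B>. U \<subseteq> V} \<subseteq> (\<lambda>B. cylinder \<nu> B x \<inter> Y) ` {B \<in> \<F>. B \<subseteq> A}"
    proof
      fix V assume "V \<in> {V \<in> \<B>. U \<subseteq> V}"
      then obtain B z where B: "B \<in> \<F>" and V: "V = cylinder \<nu> B z \<inter> Y" and "U \<subseteq> V"
        by (auto simp: \<B>_def)
      have "B \<subseteq> A"
        using cylinder_trace_subset_imp[OF \<theta> inf dense F[OF A] F[OF B] xX, of z] \<open>U \<subseteq> V\<close> U V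
        by blast
      moreover have "x \<in> cylinder \<nu> B z"
        using \<open>U \<subseteq> V\<close> U V x mem_cylinder_self[OF xX] by blast
      then have "V = cylinder \<nu> B x \<inter> Y"
        using V cylinder_eq_if_mem by blast
      ultimately show "V \<in> (\<lambda>B. cylinder \<nu> B x \<inter> Y) ` {B \<in> \<F>. B \<subseteq> A}"
        using B by blast
    qed
    then have "|{V \<in> \<B>. U \<subseteq> V}| \<le>o |{B \<in> \<F>. B \<subseteq> A}|"
      using surj_imp_ordLeq by blast
    moreover have "|{B \<in> \<F>. B \<subseteq> A}| <o \<kappa>"
      using sparse F[OF A] unfolding sparse_family_iff[OF \<kappa> \<theta>] subsets_lt_def by blast
    ultimately show "|{V \<in> \<B>. U \<subseteq> V}| <o \<kappa>"
      by (rule ordLeq_ordLess_trans)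
  qed
  ultimately show ?thesis
    unfolding has_op_like_base_def by blast
qed

section \<open>Supports of basic neighbourhoods of a point\<close>

text \<open>
  Only the basic sets containing \<open>y\<close> enter.  Their supports are cofinal because a basic set
  inside the cylinder around \<open>y\<close> with support \<open>A\<close> contains a trace inside that cylinder, which
  by density must fix all of \<open>A\<close>.
\<close>

lemma sparse_cofinal_if_has_op_like_base:
  fixes \<nu> :: "'l rel"
  assumes \<kappa>: "Card_order \<kappa>" and \<theta>: "Card_order \<theta>" and inf: "natLeq \<le>o \<theta>"
    and Y: "Y \<subseteq> topspace (cantor_cube \<nu>)" and y: "y \<in> Y"
    and dense: "lt_open_topology (cantor_cube \<nu>) \<theta> closure_of Y = topspace (cantor_cube \<nu>)"
    and base: "has_op_like_base (subtopology (lt_open_topology (cantor_cube \<nu>) \<theta>) Y) \<kappa>"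
  shows "\<exists>\<F>. sparse_family \<kappa> \<theta> \<F> \<and> cofinal_family (subsets_lt \<nu> \<theta>) \<F>"
proof -
  let ?X = "lt_open_topology (cantor_cube \<nu>) \<theta>"
  have yX: "y \<in> topspace (cantor_cube \<nu>)"
    using y Y by blast
  obtain \<B> where \<B>: "base_of (subtopology ?X Y) \<B>" and op_like: "op_like \<kappa> \<B>"
    using base by (auto simp: has_op_like_base_def)
  have open_base: "openin (subtopology ?X Y) U" if "U \<in> \<B>" for U
    using \<B> that unfolding base_of_def openin_topology_base_unique by blast
  have "\<exists>A\<in>subsets_lt \<nu> \<theta>. cylinder \<nu> A y \<inter> Y \<subseteq> U" if U: "U \<in> \<B>" "y \<in> U" for U
  proof -
    obtain S where "openin ?X S" "U = S \<inter> Y"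
      using open_base[OF U(1)] by (auto simp: openin_subtopology)
    then show ?thesis
      using U(2) openin_lt_open_cantor_cube_iff[OF \<theta> inf, of \<nu> S] by blast
  qed
  then obtain D where D: "\<And>U. U \<in> \<B> \<Longrightarrow> y \<in> U \<Longrightarrow> D U \<in> subsets_lt \<nu> \<theta>"
      "\<And>U. U \<in> \<B> \<Longrightarrow> y \<in> U \<Longrightarrow> cylinder \<nu> (D U) y \<inter> Y \<subseteq> U"
    by metis
  have small: "\<exists>V\<in>\<B>. y \<in> V \<and> V \<subseteq> cylinder \<nu> A y \<inter> Y" if "A \<in> subsets_lt \<nu> \<theta>" for A
  proof -
    have "openin (subtopology ?X Y) (cylinder \<nu> A y \<inter> Y)"
      using openin_cylinder[OF inf that] by (auto simp: openin_subtopology)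
    then show ?thesis
      using \<B> y mem_cylinder_self[OF yX]
      unfolding base_of_def openin_topology_base_unique by blast
  qed
  define \<F> where "\<F> = D ` {U \<in> \<B>. y \<in> U}"
  have F: "\<F> \<subseteq> subsets_lt \<nu> \<theta>"
    using D(1) by (auto simp: \<F>_def)
  have "sparse_family \<kappa> \<theta> \<F>"
    unfolding sparse_family_iff[OF \<kappa> \<theta>]
  proof (intro allI impI)
    fix C :: "'l set" assume C: "|C| <o \<theta>"
    \<comment> \<open>Members of the family contain coordinates only, so \<open>C\<close> may be cut down to those.\<close>
    let ?C = "C \<inter> Field \<nu>"
    have "|?C| <o \<theta>"
      using C card_of_mono1[of ?C C] ordLeq_ordLess_trans by blast
    then obtain V where V: "V \<in> \<B>" "V \<subseteq> cylinder \<nu> ?C y \<inter> Y"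
      using small[of ?C] by (auto simp: subsets_lt_def)
    have "{A \<in> \<F>. A \<subseteq> C} \<subseteq> D ` {U \<in> \<B>. V \<subseteq> U}"
    proof
      fix A assume "A \<in> {A \<in> \<F>. A \<subseteq> C}"
      then obtain U where U: "U \<in> \<B>" "y \<in> U" "A = D U" "D U \<subseteq> ?C"
        using F by (auto simp: \<F>_def subsets_lt_def)
      have "V \<subseteq> U"
        using V(2) cylinder_anti_mono[OF U(4), of \<nu> y] D(2)[OF U(1,2)] by blast
      then show "A \<in> D ` {U \<in> \<B>. V \<subseteq> U}"
        using U by blast
    qed
    then have "|{A \<in> \<F>. A \<subseteq> C}| \<le>o |{U \<in> \<B>. V \<subseteq> U}|"
      using surj_imp_ordLeq by blast
    moreover have "|{U \<in> \<B>. V \<subseteq> U}| <o \<kappa>"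
      using op_like V(1) unfolding op_like_def by blast
    ultimately show "|{A \<in> \<F>. A \<subseteq> C}| <o \<kappa>"
      by (rule ordLeq_ordLess_trans)
  qed
  moreover have "\<exists>B\<in>\<F>. A \<subseteq> B" if A: "A \<in> subsets_lt \<nu> \<theta>" for A
  proof -
    obtain U where U: "U \<in> \<B>" "y \<in> U" "U \<subseteq> cylinder \<nu> A y \<inter> Y"
      using small[OF A] by blast
    have "A \<subseteq> D U"
      using D(2)[OF U(1,2)] U(3)
      by (intro cylinder_trace_subset_imp[OF \<theta> inf dense D(1)[OF U(1,2)] A yX]) blast
    then show ?thesis
      using U(1,2) by (auto simp: \<F>_def)
  qed
  then have "cofinal_family (subsets_lt \<nu> \<theta>) \<F>"
    using F by (auto simp: cofinal_family_def)
  ultimately show ?thesis by blast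
qed

section \<open>The Noetherian type of a dense subspace\<close>

theorem theorem3p14:
  fixes \<kappa> :: "'k rel" and \<theta> :: "'t rel" and \<nu> :: "'l rel"
    and Y :: "('l \<Rightarrow> bool) set"
  assumes "Card_order \<kappa>" and "Card_order \<theta>" and "Card_order \<nu>"
    and "natLeq \<le>o \<theta>" and "\<theta> \<le>o \<kappa>" and "\<theta> \<le>o \<nu>"
    and "Y \<subseteq> topspace (lt_open_topology (cantor_cube \<nu>) \<theta>)"
    and "lt_open_topology (cantor_cube \<nu>) \<theta> closure_of Y
           = topspace (lt_open_topology (cantor_cube \<nu>) \<theta>)"
  shows "Nt (subtopology (lt_open_topology (cantor_cube \<nu>) \<theta>) Y) \<le>o \<kappa> \<longleftrightarrow>
    (\<exists>\<F>. sparse_family \<kappa> \<theta> \<F> \<and> cofinal_family (subsets_lt \<nu> \<theta>) \<F>)"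
proof -
  let ?X = "lt_open_topology (cantor_cube \<nu>) \<theta>"
  have Y: "Y \<subseteq> topspace (cantor_cube \<nu>)"
    and dense: "?X closure_of Y = topspace (cantor_cube \<nu>)"
    using assms(7,8) by (simp_all add: topspace_lt_open_topology[OF assms(4)])
  have "topspace (cantor_cube \<nu>) \<noteq> {}"
    by (simp add: topspace_cantor_cube PiE_eq_empty_iff)
  then obtain y where y: "y \<in> Y"
    using dense by fastforce
  have "natLeq \<le>o \<kappa>"
    using assms(4,5) by (rule ordLeq_transitive)
  then have "Nt (subtopology ?X Y) \<le>o \<kappa> \<longleftrightarrow> has_op_like_base (subtopology ?X Y) \<kappa>"
    using Nt_least[OF assms(1)] has_op_like_base_mono[OF has_op_like_base_Nt] by blast
  then show ?thesis
    using has_op_like_base_if_sparse_cofinal[OF assms(1,2,4) Y dense]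
      sparse_cofinal_if_has_op_like_base[OF assms(1,2,4) Y y dense] by blast
qed

end
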